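(* Let $k$ and $N>1$ be integers. Suppose that the complete graph $K_N$ is factorable into spanning subgraphs $H_1,H_2,\ldots,H_k$, where for each $i\in[k]$, $H_i\cong r_iK_{q_i+1}\cup(n_i-r_i)K_{q_i}$ (the disjoint union of $r_i$ copies of $K_{q_i+1}$ and $n_i-r_i$ copies of $K_{q_i}$) for some non-negative integers $n_i,q_i,r_i$ satisfying $N=n_iq_i+r_i$ and $0\le r_i<n_i$. Assume further that $(n_i-r_i-1)q_i>0$ for some $i\in[k]$. Then $$\bar{R}(n_1+1,n_2+1,\ldots,n_k+1)=N+1.$$
   Context: For a positive integer $n$, $[n]=\{1,\dots,n\}$. For positive integers $n,k$, an edge-coloring of $K_n$ with $k$ colors is a map $f:\binom{[n]}{2}\to[k]$. For $i\in[k]$, $f^{-1}(i)$ denotes the graph on vertex set $[n]$ whose edges are the pairs of color $i$, and $\alpha_i(f)$ denotes the independence number of this graph. For positive integers $m_1,\dots,m_k$, the complementary Ramsey number $\bar{R}(m_1,\dots,m_k)$ is the least positive integer $n$ such that for every edge-coloring $f$ of $K_n$ with $k$ colors there exists $i\in[k]$ with $\alpha_i(f)\ge m_i$. A graph $G$ is factorable into spanning subgraphs $H_1,\dots,H_k$ if these are spanning subgraphs of $G$ whose edge sets partition the edge set of $G$. *)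

theory Defs
  imports Main "HOL-Library.Ramsey" "HOL-Library.Disjoint_Sets"
begin

text \<open>A finite simple graph is given by its vertex set and a set of two-element sets of vertices.\<close>

record 'a ugraph =
  verts :: "'a set"
  edges :: "'a set set"

definition simple_graph :: "'a ugraph \<Rightarrow> bool" where
  "simple_graph G \<longleftrightarrow> finite (verts G) \<and> edges G \<subseteq> [verts G]\<^bsup>2\<^esup>"

definition graph_iso :: "'a ugraph \<Rightarrow> 'b ugraph \<Rightarrow> bool"  (infix \<open>\<cong>\<^sub>g\<close> 50) where
  "G \<cong>\<^sub>g H \<longleftrightarrow> (\<exists>\<phi>. bij_betw \<phi> (verts G) (verts H) \<and>
     (\<forall>u\<in>verts G. \<forall>v\<in>verts G. {u, v} \<in> edges G \<longleftrightarrow> {\<phi> u, \<phi> v} \<in> edges H))"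

definition complete_graph :: "nat \<Rightarrow> nat ugraph" where
  "complete_graph n = \<lparr>verts = {1..n}, edges = [{1..n}]\<^bsup>2\<^esup>\<rparr>"

definition graph_copies :: "nat \<Rightarrow> 'a ugraph \<Rightarrow> (nat \<times> 'a) ugraph" where
  "graph_copies m G =
     \<lparr>verts = {1..m} \<times> verts G,
      edges = {Pair j ` e |j e. j \<in> {1..m} \<and> e \<in> edges G}\<rparr>"

definition disjoint_graph_union :: "'a ugraph \<Rightarrow> 'b ugraph \<Rightarrow> ('a + 'b) ugraph" where
  "disjoint_graph_union G H =
     \<lparr>verts = verts G <+> verts H,
      edges = image Inl ` edges G \<union> image Inr ` edges H\<rparr>"

definition spanning_subgraph :: "'a ugraph \<Rightarrow> 'a ugraph \<Rightarrow> bool" where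
  "spanning_subgraph H G \<longleftrightarrow>
     simple_graph H \<and> verts H = verts G \<and> edges H \<subseteq> edges G"

text \<open>Edgeless factors are allowed, so the partition is an indexed one whose parts may be empty.\<close>

definition factorable_into :: "'a ugraph \<Rightarrow> nat \<Rightarrow> (nat \<Rightarrow> 'a ugraph) \<Rightarrow> bool" where
  "factorable_into G k H \<longleftrightarrow>
     (\<forall>i\<in>{1..k}. spanning_subgraph (H i) G) \<and>
     disjoint_family_on (\<lambda>i. edges (H i)) {1..k} \<and>
     (\<Union>i\<in>{1..k}. edges (H i)) = edges G"

definition independence_number :: "'a ugraph \<Rightarrow> nat" where
  "independence_number G = Max (card ` {S. S \<subseteq> verts G \<and> indep S (edges G)})"

definition edge_colorings :: "nat \<Rightarrow> nat \<Rightarrow> (nat set \<Rightarrow> nat) set" where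
  "edge_colorings n k = [{1..n}]\<^bsup>2\<^esup> \<rightarrow> {1..k}"

definition color_graph :: "nat \<Rightarrow> (nat set \<Rightarrow> nat) \<Rightarrow> nat \<Rightarrow> nat ugraph" where
  "color_graph n f i = \<lparr>verts = {1..n}, edges = {e \<in> [{1..n}]\<^bsup>2\<^esup>. f e = i}\<rparr>"

definition complementary_Ramsey_property :: "nat \<Rightarrow> (nat \<Rightarrow> nat) \<Rightarrow> nat \<Rightarrow> bool" where
  "complementary_Ramsey_property k m n \<longleftrightarrow>
     (\<forall>f\<in>edge_colorings n k. \<exists>i\<in>{1..k}. independence_number (color_graph n f i) \<ge> m i)"

text \<open>The parameters \<open>m\<^sub>1, \<dots>, m\<^sub>k\<close> are the values of \<open>m\<close> on \<open>{1..k}\<close>. If no suitable \<open>n\<close> exists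
  (for instance if \<open>k = 1\<close> and \<open>m\<^sub>1 \<ge> 2\<close>), the value is 0; hence an equation with a positive
  right-hand side includes the existence of the number.\<close>

definition complementary_Ramsey :: "nat \<Rightarrow> (nat \<Rightarrow> nat) \<Rightarrow> nat" where
  "complementary_Ramsey k m =
     (if \<exists>n>0. complementary_Ramsey_property k m n
      then LEAST n. n > 0 \<and> complementary_Ramsey_property k m n
      else 0)"

end

theory Submission
  imports Defs Complex_Main
begin

text \<open>
  Colouring \<open>K\<^sub>N\<close> by the factors gives \<open>\<alpha>\<^sub>i \<le> n\<^sub>i\<close>, because an independent set meets each of
  the \<open>n\<^sub>i\<close> cliques at most once; hence the number exceeds \<open>N\<close>.

  Conversely, suppose a colouring of \<open>K\<^bsub>N+1\<^esub>\<close> has \<open>\<alpha>\<^sub>i \<le> n\<^sub>i\<close> for all \<open>i\<close>, and let \<open>d\<^sub>i(v)\<close> be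
  the degrees. The Caro--Wei bound \<open>\<Sum>\<^sub>v 1/(d\<^sub>i(v)+1) \<le> \<alpha>\<^sub>i\<close> and the identity
  \<open>d = 2q - q(q+1)/(d+1) + (d-q)(d-q+1)/(d+1)\<close>, whose last summand is non-negative for integers,
  bound each \<open>\<Sum>\<^sub>v d\<^sub>i(v)\<close> from below by the Turan number. Comparing the sum over \<open>i\<close> with the
  degree count in the given factorization yields \<open>\<Sum>\<^sub>i q\<^sub>i \<le> N\<close>. The degrees in \<open>H\<^sub>i\<close> are
  \<open>q\<^sub>i\<close> or \<open>q\<^sub>i - 1\<close>, and the latter occurs for some \<open>i\<close> with \<open>q\<^sub>i > 0\<close>, so \<open>\<Sum>\<^sub>i q\<^sub>i \<ge> N\<close>. Thus
  equality holds everywhere, which forces \<open>d\<^sub>i(v) = q\<^sub>i\<close> for all \<open>i\<close> and \<open>v\<close>, and then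
  \<open>N + 1 = n\<^sub>i(q\<^sub>i + 1)\<close>, that is \<open>r\<^sub>i = n\<^sub>i - 1\<close>, whenever \<open>q\<^sub>i > 0\<close>.
\<close>

section \<open>Degrees, independent sets and the Caro--Wei bound\<close>

definition neighbours :: "'a ugraph \<Rightarrow> 'a \<Rightarrow> 'a set" where
  "neighbours G v = {u \<in> verts G. u \<noteq> v \<and> {u, v} \<in> edges G}"

abbreviation degree :: "'a ugraph \<Rightarrow> 'a \<Rightarrow> nat" where
  "degree G v \<equiv> card (neighbours G v)"

lemma finite_neighbours: "finite (verts G) \<Longrightarrow> finite (neighbours G v)"
  by (simp add: neighbours_def)

lemma indep_card_le_independence_number:
  assumes "finite (verts G)" "S \<subseteq> verts G" "indep S (edges G)"
  shows "card S \<le> independence_number G"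
  unfolding independence_number_def using assms by (intro Max_ge) auto

lemma independence_number_attained:
  assumes "finite (verts G)"
  obtains S where "S \<subseteq> verts G" "indep S (edges G)" "card S = independence_number G"
proof -
  let ?A = "{S. S \<subseteq> verts G \<and> indep S (edges G)}"
  have "{} \<in> ?A" by (simp add: indep_def)
  then have "Max (card ` ?A) \<in> card ` ?A"
    using assms by (intro Max_in) (auto simp del: mem_Collect_eq)
  then show thesis
    using that by (auto simp: independence_number_def)
qed

text \<open>Greedy choice: a vertex of minimal degree together with its neighbours contributes at
  most 1 to the sum.\<close>

lemma Caro_Wei_indep:
  assumes "finite (verts G)"
  shows "\<exists>S\<subseteq>verts G. indep S (edges G) \<and>
           (\<Sum>v\<in>verts G. 1 / (real (degree G v) + 1)) \<le> real (card S)"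
  using assms
proof (induction "card (verts G)" arbitrary: G rule: less_induct)
  case less
  show ?case
  proof (cases "verts G = {}")
    case True
    then show ?thesis by (auto simp: indep_def)
  next
    case False
    obtain v where v: "v \<in> verts G" and vmin: "\<And>u. u \<in> verts G \<Longrightarrow> degree G v \<le> degree G u"
      using arg_min_if_finite[OF less.prems False, of "degree G"]
      by (metis not_le_imp_less)
    define B where "B = insert v (neighbours G v)"
    \<comment> \<open>Only the vertex set shrinks; the old edges may stay, since
      \<open>neighbours\<close> and independence look only at pairs of remaining vertices.\<close>
    define G' where "G' = G\<lparr>verts := verts G - B\<rparr>"
    have B: "B \<subseteq> verts G" "finite B" "v \<in> B"
      using v less.prems by (auto simp: B_def neighbours_def)
    have cardB: "card B = degree G v + 1"
      using less.prems by (simp add: B_def finite_neighbours) (simp add: neighbours_def)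
    have "card (verts G') < card (verts G)"
      unfolding G'_def using B v less.prems by (auto intro!: psubset_card_mono)
    then obtain S where S: "S \<subseteq> verts G'" "indep S (edges G')"
        "(\<Sum>u\<in>verts G'. 1 / (real (degree G' u) + 1)) \<le> real (card S)"
      using less.hyps[of G'] less.prems by (auto simp: G'_def)
    have fS: "finite S" and vS: "v \<notin> S"
      using S(1) less.prems B(3) by (auto simp: G'_def intro: finite_subset)
    have "indep (insert v S) (edges G)"
      using S(1,2) by (auto simp: indep_def G'_def B_def neighbours_def insert_commute)
    moreover have "insert v S \<subseteq> verts G"
      using S(1) v by (auto simp: G'_def)
    moreover have "(\<Sum>u\<in>verts G. 1 / (real (degree G u) + 1)) \<le> real (card (insert v S))"
    proof -
      have "(\<Sum>u\<in>B. 1 / (real (degree G u) + 1)) \<le> (\<Sum>u\<in>B. 1 / (real (degree G v) + 1))"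
        using B vmin by (intro sum_mono frac_le) auto
      also have "\<dots> = 1" by (simp add: cardB field_simps)
      finally have 1: "(\<Sum>u\<in>B. 1 / (real (degree G u) + 1)) \<le> 1" .
      \<comment> \<open>Deleting vertices can only lower degrees, so the remaining summands do not
        decrease.\<close>
      have "degree G' u \<le> degree G u" for u
        using less.prems by (intro card_mono) (auto simp: G'_def neighbours_def)
      then have "(\<Sum>u\<in>verts G - B. 1 / (real (degree G u) + 1))
          \<le> (\<Sum>u\<in>verts G'. 1 / (real (degree G' u) + 1))"
        unfolding G'_def by (auto intro!: sum_mono frac_le simp: G'_def)
      with 1 S(3) show ?thesis
        using sum.subset_diff[OF B(1) less.prems, of "\<lambda>u. 1 / (real (degree G u) + 1)"] fS vS
        by simp
    qed
    ultimately show ?thesis by blast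
  qed
qed

lemma Caro_Wei:
  assumes "finite (verts G)"
  shows "(\<Sum>v\<in>verts G. 1 / (real (degree G v) + 1)) \<le> real (independence_number G)"
  using Caro_Wei_indep[OF assms] indep_card_le_independence_number[OF assms]
  by (meson of_nat_le_iff order_trans)

section \<open>Degree sums and their slack\<close>

definition degree_defect :: "nat \<Rightarrow> nat \<Rightarrow> real" where
  "degree_defect q d = (real d - real q) * (real d - real q + 1) / (real d + 1)"

text \<open>The numerator is a product of two consecutive integers. For q > 0 the defect is q(q+1)
  times the gap between the convex function 1/(d+1) and its chord through d = q - 1 and d =
  q.\<close>

lemma degree_defect_nonneg: "degree_defect q d \<ge> 0"
proof (cases "q \<le> d")
  case True
  then show ?thesis by (simp add: degree_defect_def)
next
  case False
  then have "real d + 1 \<le> real q" by linarith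
  then show ?thesis by (simp add: degree_defect_def mult_nonpos_nonpos)
qed

text \<open>The zeros are d = q and d = q - 1. The upper bound suffices, since equality will follow
  from the degree count at each vertex.\<close>

lemma degree_defect_eq_0D: "degree_defect q d = 0 \<Longrightarrow> d \<le> q"
  by (auto simp: degree_defect_def)

lemma degree_eq_defect:
  "real d = 2 * real q - real q * (real q + 1) * (1 / (real d + 1)) + degree_defect q d"
proof -
  have "(real d - real q) * (real d - real q + 1) =
      (real d - 2 * real q) * (real d + 1) + real q * (real q + 1)"
    by (simp add: algebra_simps)
  moreover have "real d + 1 \<noteq> 0" by linarith
  ultimately show ?thesis by (simp add: degree_defect_def add_divide_distrib)
qed

text \<open>Here \<open>m\<close> is free. If it bounds the independence number, the last two
  summands are non-negative: the slack in Caro--Wei and the total defect.\<close>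

lemma sum_degree_eq_defect:
  "(\<Sum>v\<in>verts G. real (degree G v)) =
     2 * real q * real (card (verts G)) - real q * (real q + 1) * real m
     + real q * (real q + 1) * (real m - (\<Sum>v\<in>verts G. 1 / (real (degree G v) + 1)))
     + (\<Sum>v\<in>verts G. degree_defect q (degree G v))"
proof -
  have "(\<Sum>v\<in>verts G. real (degree G v)) = (\<Sum>v\<in>verts G. 2 * real q
      - real q * (real q + 1) * (1 / (real (degree G v) + 1)) + degree_defect q (degree G v))"
    by (rule sum.cong[OF refl], rule degree_eq_defect)
  then show ?thesis
    by (simp only: sum.distrib sum_subtractf sum_distrib_left[symmetric] sum_constant)
      (simp add: algebra_simps)
qed

section \<open>Factorizations of complete graphs as edge-colourings\<close>

lemma sum_degree_factorization:
  assumes "factorable_into (complete_graph M) k H" "v \<in> {1..M}"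
  shows "(\<Sum>i\<in>{1..k}. degree (H i) v) = M - 1"
proof -
  have V: "verts (H i) = {1..M}" if "i \<in> {1..k}" for i
    using assms that by (auto simp: factorable_into_def spanning_subgraph_def complete_graph_def)
  have E: "(\<Union>i\<in>{1..k}. edges (H i)) = [{1..M}]\<^bsup>2\<^esup>"
    using assms by (simp add: factorable_into_def complete_graph_def)
  have D: "edges (H i) \<inter> edges (H j) = {}" if "i \<in> {1..k}" "j \<in> {1..k}" "i \<noteq> j" for i j
    using assms that by (auto simp: factorable_into_def disjoint_family_on_def)
  have "(\<Union>i\<in>{1..k}. neighbours (H i) v) = {1..M} - {v}"
  proof (intro equalityI subsetI)
    fix u assume u: "u \<in> {1..M} - {v}"
    then have "{u, v} \<in> [{1..M}]\<^bsup>2\<^esup>" using assms(2) by (auto simp: nsets_def)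
    then obtain i where "i \<in> {1..k}" "{u, v} \<in> edges (H i)" using E by blast
    then show "u \<in> (\<Union>i\<in>{1..k}. neighbours (H i) v)"
      using u V by (auto simp: neighbours_def)
  qed (auto simp: neighbours_def V)
  moreover have "card (\<Union>i\<in>{1..k}. neighbours (H i) v) = (\<Sum>i\<in>{1..k}. degree (H i) v)"
    using D V by (intro card_UN_disjoint) (auto simp: neighbours_def disjoint_iff)
  ultimately show ?thesis using assms(2) by simp
qed

lemma factorable_into_color_graph:
  assumes "f \<in> edge_colorings M k"
  shows "factorable_into (complete_graph M) k (color_graph M f)"
  using assms
  by (auto simp: factorable_into_def spanning_subgraph_def complete_graph_def color_graph_def
      simple_graph_def disjoint_family_on_def edge_colorings_def)

lemma factorization_coloring:
  assumes "factorable_into (complete_graph M) k H"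
  obtains f where "f \<in> edge_colorings M k"
    "\<And>e i. i \<in> {1..k} \<Longrightarrow> e \<in> edges (H i) \<Longrightarrow> f e = i"
proof -
  have E: "(\<Union>i\<in>{1..k}. edges (H i)) = [{1..M}]\<^bsup>2\<^esup>"
    using assms by (simp add: factorable_into_def complete_graph_def)
  have D: "i = j" if "i \<in> {1..k}" "j \<in> {1..k}" "e \<in> edges (H i)" "e \<in> edges (H j)" for i j e
    using assms that unfolding factorable_into_def disjoint_family_on_def by blast
  \<comment> \<open>Off the edges of the complete graph the value is unspecified, which
    \<open>edge_colorings\<close> permits.\<close>
  define f where "f e = (THE i. i \<in> {1..k} \<and> e \<in> edges (H i))" for e
  have f: "f e = i" if "i \<in> {1..k}" "e \<in> edges (H i)" for e i
    unfolding f_def using that D by (intro the_equality) blast+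
  have f': "f e \<in> {1..k}" if e: "e \<in> [{1..M}]\<^bsup>2\<^esup>" for e
  proof -
    obtain i where "i \<in> {1..k}" "e \<in> edges (H i)" using E e by blast
    then show ?thesis using f by metis
  qed
  show thesis
    by (rule that[of f]) (use f f' in \<open>auto simp: edge_colorings_def\<close>)
qed

section \<open>Disjoint unions of cliques of sizes q and q + 1\<close>

abbreviation (input) near_equal_cliques :: "nat \<Rightarrow> nat \<Rightarrow> nat \<Rightarrow> (nat \<times> nat + nat \<times> nat) ugraph" where
  "near_equal_cliques n q r \<equiv> disjoint_graph_union
     (graph_copies r (complete_graph (q + 1))) (graph_copies (n - r) (complete_graph q))"

lemma edge_graph_copies_complete:
  "{(i, x), (j, y)} \<in> edges (graph_copies m (complete_graph q)) \<longleftrightarrow>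
     i = j \<and> x \<noteq> y \<and> i \<in> {1..m} \<and> x \<in> {1..q} \<and> y \<in> {1..q}"
proof
  assume "{(i, x), (j, y)} \<in> edges (graph_copies m (complete_graph q))"
  then obtain l e where l: "l \<in> {1..m}" and e: "e \<subseteq> {1..q}" "card e = 2"
      and eq: "{(i, x), (j, y)} = Pair l ` e"
    by (auto simp: graph_copies_def complete_graph_def nsets_def)
  have "i = l" "j = l" "x \<in> e" "y \<in> e" using eq by (auto simp: set_eq_iff image_iff)
  moreover have "x \<noteq> y"
  proof
    assume "x = y"
    with eq \<open>i = l\<close> \<open>j = l\<close> have "Pair l ` e = {(l, x)}" by simp
    then have "card (Pair l ` e) = 1" by simp
    moreover have "card (Pair l ` e) = card e" by (intro card_image) (auto simp: inj_on_def)
    ultimately show False using e by simp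
  qed
  ultimately show "i = j \<and> x \<noteq> y \<and> i \<in> {1..m} \<and> x \<in> {1..q} \<and> y \<in> {1..q}"
    using l e by auto
next
  assume a: "i = j \<and> x \<noteq> y \<and> i \<in> {1..m} \<and> x \<in> {1..q} \<and> y \<in> {1..q}"
  then have "{x, y} \<in> [{1..q}]\<^bsup>2\<^esup>" "{(i, x), (j, y)} = Pair i ` {x, y}"
    by (auto simp: nsets_def)
  with a show "{(i, x), (j, y)} \<in> edges (graph_copies m (complete_graph q))"
    by (simp only: graph_copies_def complete_graph_def ugraph.simps mem_Collect_eq) blast
qed

lemma edge_disjoint_graph_union:
  shows "{Inl a, Inl b} \<in> edges (disjoint_graph_union G H) \<longleftrightarrow> {a, b} \<in> edges G"
    and "{Inr c, Inr d} \<in> edges (disjoint_graph_union G H) \<longleftrightarrow>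
          {c, d} \<in> edges H"
    and "{Inl a, Inr d} \<notin> edges (disjoint_graph_union G H)"
    and "{Inr d, Inl a} \<notin> edges (disjoint_graph_union G H)"
proof -
  have L: "{Inl a, Inl b} = Inl ` {a, b}" for a b :: 'a by simp
  have R: "{Inr c, Inr d} = Inr ` {c, d}" for c d :: 'b by simp
  show "{Inl a, Inl b} \<in> edges (disjoint_graph_union G H) \<longleftrightarrow> {a, b} \<in> edges G"
    unfolding L disjoint_graph_union_def
    by (auto simp: inj_image_eq_iff simp del: image_insert)
  show "{Inr c, Inr d} \<in> edges (disjoint_graph_union G H) \<longleftrightarrow> {c, d} \<in> edges H"
    unfolding R disjoint_graph_union_def
    by (auto simp: inj_image_eq_iff simp del: image_insert)
  show "{Inl a, Inr d} \<notin> edges (disjoint_graph_union G H)"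
       "{Inr d, Inl a} \<notin> edges (disjoint_graph_union G H)"
    unfolding disjoint_graph_union_def by (auto simp: set_eq_iff image_iff)
qed

text \<open>The labelling \<open>g\<close> names the clique containing a vertex: \<open>Inl\<close> for those of size \<open>q + 1\<close>,
  \<open>Inr\<close> for those of size \<open>q\<close>, which are empty if \<open>q = 0\<close>.\<close>

lemma near_equal_cliques_labelling:
  assumes "G \<cong>\<^sub>g near_equal_cliques n q r"
  obtains g :: "'a \<Rightarrow> nat + nat"
  where "g \<in> verts G \<rightarrow> {1..r} <+> {1..n - r}"
    and "\<And>u v. u \<in> verts G \<Longrightarrow> v \<in> verts G \<Longrightarrow> {u, v} \<in> edges G \<longleftrightarrow> u \<noteq> v \<and> g u = g v"
    and "\<And>j. j \<in> {1..r} \<Longrightarrow> card {v \<in> verts G. g v = Inl j} = q + 1"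
    and "\<And>j. j \<in> {1..n - r} \<Longrightarrow> card {v \<in> verts G. g v = Inr j} = q"
proof -
  let ?K = "near_equal_cliques n q r"
  obtain \<phi> where bij: "bij_betw \<phi> (verts G) (verts ?K)"
    and iso: "\<And>u v. u \<in> verts G \<Longrightarrow> v \<in> verts G \<Longrightarrow>
      {u, v} \<in> edges G \<longleftrightarrow> {\<phi> u, \<phi> v} \<in> edges ?K"
    using assms unfolding graph_iso_def by blast
  \<comment> \<open>This forgets the position inside a clique and keeps the side and index of the
    clique.\<close>
  let ?l = "map_sum fst fst :: nat \<times> nat + nat \<times> nat \<Rightarrow> nat + nat"
  have VK: "verts ?K = ({1..r} \<times> {1..q + 1}) <+> ({1..n - r} \<times> {1..q})"
    by (simp add: disjoint_graph_union_def graph_copies_def complete_graph_def)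
  have EK: "{x, y} \<in> edges ?K \<longleftrightarrow> x \<noteq> y \<and> ?l x = ?l y"
    if "x \<in> verts ?K" "y \<in> verts ?K" for x y
    using that unfolding VK
    by (elim PlusE SigmaE)
      (simp_all only: edge_disjoint_graph_union edge_graph_copies_complete map_sum.simps
        sum.inject prod.inject sum.distinct fst_conv, auto)
  have inK: "\<phi> v \<in> verts ?K" if "v \<in> verts G" for v
    using bij that by (auto dest: bij_betwE)
  have cl: "card {v \<in> verts G. ?l (\<phi> v) = c} = card {x \<in> verts ?K. ?l x = c}" for c
  proof -
    have img: "\<phi> ` {v \<in> verts G. ?l (\<phi> v) = c} = {x \<in> verts ?K. ?l x = c}"
      using bij by (auto simp: bij_betw_def)
    have "inj_on \<phi> {v \<in> verts G. ?l (\<phi> v) = c}"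
      using bij by (auto simp: bij_betw_def inj_on_def)
    from card_image[OF this] show ?thesis unfolding img by (rule sym)
  qed
  show thesis
  proof (rule that[of "?l \<circ> \<phi>"])
    show "?l \<circ> \<phi> \<in> verts G \<rightarrow> {1..r} <+> {1..n - r}"
      using inK unfolding VK by fastforce
    show "{u, v} \<in> edges G \<longleftrightarrow> u \<noteq> v \<and> (?l \<circ> \<phi>) u = (?l \<circ> \<phi>) v"
      if "u \<in> verts G" "v \<in> verts G" for u v
      using iso[OF that] EK[OF inK inK, OF that] bij that by (auto simp: bij_betw_def inj_on_def)
    show "card {v \<in> verts G. (?l \<circ> \<phi>) v = Inl j} = q + 1" if j: "j \<in> {1..r}" for j
    proof -
      have "{x \<in> verts ?K. ?l x = Inl j} = (\<lambda>x. Inl (j, x)) ` {1..q + 1}"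
        using j unfolding VK by auto
      then show ?thesis using cl[of "Inl j"] by (simp add: card_image inj_on_def)
    qed
    show "card {v \<in> verts G. (?l \<circ> \<phi>) v = Inr j} = q" if j: "j \<in> {1..n - r}" for j
    proof -
      have "{x \<in> verts ?K. ?l x = Inr j} = (\<lambda>x. Inr (j, x)) ` {1..q}"
        using j unfolding VK by auto
      then show ?thesis using cl[of "Inr j"] by (simp add: card_image inj_on_def)
    qed
  qed
qed

lemma near_equal_cliques_indep_card:
  assumes "G \<cong>\<^sub>g near_equal_cliques n q r" "r < n" "S \<subseteq> verts G" "indep S (edges G)"
  shows "card S \<le> n"
proof -
  obtain g :: "'a \<Rightarrow> nat + nat" where g: "g \<in> verts G \<rightarrow> {1..r} <+> {1..n - r}"
    and E: "\<And>u v. u \<in> verts G \<Longrightarrow> v \<in> verts G \<Longrightarrow> {u, v} \<in> edges G \<longleftrightarrow> u \<noteq> v \<and> g u = g v"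
    by (rule near_equal_cliques_labelling[OF assms(1)]) blast
  have "inj_on g S"
    using assms(3,4) E by (fastforce simp: inj_on_def indep_def)
  moreover have "g ` S \<subseteq> {1..r} <+> {1..n - r}"
    using g assms(3) by blast
  ultimately have "card S \<le> card ({1..r} <+> {1..n - r})"
    by (intro card_inj_on_le) auto
  then show ?thesis using assms(2) by (simp add: card_Plus)
qed

text \<open>Degrees are q in the larger cliques and q - 1 in the smaller ones, of which r < n leaves
  at least one. The sum r(q+1)q + (n-r)q(q-1) is put in the form of the leading terms of
  \<open>sum_degree_eq_defect\<close> with m = n.\<close>

lemma near_equal_cliques_degrees:
  assumes "G \<cong>\<^sub>g near_equal_cliques n q r" "finite (verts G)" "r < n"
  shows "\<And>v. v \<in> verts G \<Longrightarrow> degree G v \<le> q"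
    and "q > 0 \<Longrightarrow> \<exists>v\<in>verts G. degree G v < q"
    and "(\<Sum>v\<in>verts G. real (degree G v)) =
           2 * real q * real (n * q + r) - real q * (real q + 1) * real n"
proof -
  obtain g :: "'a \<Rightarrow> nat + nat" where g: "g \<in> verts G \<rightarrow> {1..r} <+> {1..n - r}"
    and E: "\<And>u v. u \<in> verts G \<Longrightarrow> v \<in> verts G \<Longrightarrow> {u, v} \<in> edges G \<longleftrightarrow> u \<noteq> v \<and> g u = g v"
    and L: "\<And>j. j \<in> {1..r} \<Longrightarrow> card {v \<in> verts G. g v = Inl j} = q + 1"
    and R: "\<And>j. j \<in> {1..n - r} \<Longrightarrow> card {v \<in> verts G. g v = Inr j} = q"
    by (rule near_equal_cliques_labelling[OF assms(1)]) blast
  have deg: "degree G v = card {u \<in> verts G. g u = g v} - 1" if "v \<in> verts G" for v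
  proof -
    have "neighbours G v = {u \<in> verts G. g u = g v} - {v}"
      using that E by (auto simp: neighbours_def)
    then show ?thesis using that assms(2) by simp
  qed
  have dL: "degree G v = q" if "v \<in> verts G" "g v = Inl j" "j \<in> {1..r}" for v j
    using deg[OF that(1)] L[OF that(3)] that(2) by simp
  have dR: "degree G v = q - 1" if "v \<in> verts G" "g v = Inr j" "j \<in> {1..n - r}" for v j
    using deg[OF that(1)] R[OF that(3)] that(2) by simp
  show "degree G v \<le> q" if v: "v \<in> verts G" for v
  proof -
    have "g v \<in> {1..r} <+> {1..n - r}" using g v by blast
    then show ?thesis using dL[OF v] dR[OF v] by (elim PlusE) auto
  qed
  show "\<exists>v\<in>verts G. degree G v < q" if "q > 0"
  proof -
    have 1: "1 \<in> {1..n - r}" using assms(3) by auto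
    then have "{v \<in> verts G. g v = Inr 1} \<noteq> {}" using R[OF 1] that by (metis card.empty less_irrefl)
    then obtain v where v: "v \<in> verts G" "g v = Inr 1" by blast
    then show ?thesis using dR[OF v 1] that by (intro bexI[of _ v]) auto
  qed
  let ?d = "\<lambda>c. \<Sum>v\<in>{v \<in> verts G. g v = c}. real (degree G v)"
  have "(\<Sum>v\<in>verts G. real (degree G v)) = sum ?d ({1..r} <+> {1..n - r})"
    using g assms(2) by (intro sum.group[symmetric]) auto
  also have "\<dots> = (\<Sum>j\<in>{1..r}. ?d (Inl j)) + (\<Sum>j\<in>{1..n - r}. ?d (Inr j))"
    by (subst sum.Plus) auto
  also have "(\<Sum>j\<in>{1..r}. ?d (Inl j)) = (\<Sum>j\<in>{1..r}. (real q + 1) * real q)"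
  proof (rule sum.cong[OF refl])
    fix j assume j: "j \<in> {1..r}"
    have "?d (Inl j) = (\<Sum>v\<in>{v \<in> verts G. g v = Inl j}. real q)"
      using dL j by (intro sum.cong) auto
    then show "?d (Inl j) = (real q + 1) * real q" using L[OF j] by simp
  qed
  also have "(\<Sum>j\<in>{1..n - r}. ?d (Inr j)) = (\<Sum>j\<in>{1..n - r}. real q * (real q - 1))"
  proof (rule sum.cong[OF refl])
    fix j assume j: "j \<in> {1..n - r}"
    have "?d (Inr j) = (\<Sum>v\<in>{v \<in> verts G. g v = Inr j}. real (q - 1))"
      using dR j by (intro sum.cong) auto
    \<comment> \<open>For q = 0 the truncated q - 1 differs from the real one, but the class is
      empty and both sides are 0.\<close>
    then show "?d (Inr j) = real q * (real q - 1)" using R[OF j] by (cases q) auto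
  qed
  finally show "(\<Sum>v\<in>verts G. real (degree G v)) =
      2 * real q * real (n * q + r) - real q * (real q + 1) * real n"
    using assms(3) by (simp add: of_nat_diff algebra_simps)
qed

section \<open>Lower and upper bounds for the complementary Ramsey number\<close>

lemma not_complementary_Ramsey_property_if_factorable:
  assumes fac: "factorable_into (complete_graph N) k H"
    and bound: "\<And>i S. i \<in> {1..k} \<Longrightarrow> S \<subseteq> {1..N} \<Longrightarrow> indep S (edges (H i)) \<Longrightarrow> card S < m i"
    and "M \<le> N"
  shows "\<not> complementary_Ramsey_property k m M"
proof
  assume P: "complementary_Ramsey_property k m M"
  obtain f where f: "f \<in> edge_colorings N k"
      and fH: "\<And>e i. i \<in> {1..k} \<Longrightarrow> e \<in> edges (H i) \<Longrightarrow> f e = i"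
    using factorization_coloring[OF fac] by metis
  \<comment> \<open>The colouring of the larger complete graph is restricted to [M]; excluding every
    M \<le> N is what minimality of N + 1 requires.\<close>
  have sub: "[{1..M}]\<^bsup>2\<^esup> \<subseteq> [{1..N}]\<^bsup>2\<^esup>"
    using \<open>M \<le> N\<close> by (intro nsets_mono) auto
  then have "f \<in> edge_colorings M k"
    using f by (auto simp: edge_colorings_def)
  then obtain i where i: "i \<in> {1..k}" "m i \<le> independence_number (color_graph M f i)"
    using P by (auto simp: complementary_Ramsey_property_def)
  obtain S where S: "S \<subseteq> {1..M}" "indep S (edges (color_graph M f i))"
      "card S = independence_number (color_graph M f i)"
    using independence_number_attained[of "color_graph M f i"] by (auto simp: color_graph_def)
  have "indep S (edges (H i))"
    using S(1,2) fH[OF i(1)] by (fastforce simp: indep_def color_graph_def nsets_def)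
  then show False
    using bound[OF i(1), of S] S \<open>M \<le> N\<close> i(2) by fastforce
qed

theorem theorem4p4:
  fixes k N :: nat
    and H :: "nat \<Rightarrow> nat ugraph"
    and n q r :: "nat \<Rightarrow> nat"
  assumes "N > 1"
    and "factorable_into (complete_graph N) k H"
    and "\<forall>i\<in>{1..k}.
           H i \<cong>\<^sub>g disjoint_graph_union
                   (graph_copies (r i) (complete_graph (q i + 1)))
                   (graph_copies (n i - r i) (complete_graph (q i)))"
    and "\<forall>i\<in>{1..k}. N = n i * q i + r i \<and> 0 \<le> r i \<and> r i < n i"
    and "\<exists>i\<in>{1..k}. (n i - r i - 1) * q i > 0"
  shows "complementary_Ramsey k (\<lambda>i. n i + 1) = N + 1"
proof -
  let ?P = "complementary_Ramsey_property k (\<lambda>i. n i + 1)"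
  have VH: "verts (H i) = {1..N}" if "i \<in> {1..k}" for i
    using assms(2) that
    by (auto simp: factorable_into_def spanning_subgraph_def complete_graph_def)
  have iso: "H i \<cong>\<^sub>g near_equal_cliques (n i) (q i) (r i)"
    and N: "N = n i * q i + r i" and rn: "r i < n i" if "i \<in> {1..k}" for i
    using assms(3,4) that by auto
  have finH: "finite (verts (H i))" if "i \<in> {1..k}" for i
    using VH[OF that] by simp
  obtain s where s: "s \<in> {1..k}" "(n s - r s - 1) * q s > 0"
    using assms(5) by blast
  have lower: "\<not> ?P M" if "M \<le> N" for M
    using assms(2) _ that
  proof (rule not_complementary_Ramsey_property_if_factorable)
    show "card S < n i + 1" if "i \<in> {1..k}" "S \<subseteq> {1..N}" "indep S (edges (H i))" for i S
      using near_equal_cliques_indep_card[OF iso rn, of i S] that VH by auto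
  qed
  have sumq: "N \<le> (\<Sum>i\<in>{1..k}. q i)"
  proof -
    obtain v where v: "v \<in> {1..N}" "degree (H s) v < q s"
      using near_equal_cliques_degrees(2)[OF iso finH rn, of s] s VH by auto
    have "(\<Sum>i\<in>{1..k}. degree (H i) v) < (\<Sum>i\<in>{1..k}. q i)"
      using near_equal_cliques_degrees(1)[OF iso finH rn] v s(1) VH
      by (intro sum_strict_mono_ex1) auto
    then show ?thesis
      using sum_degree_factorization[OF assms(2) v(1)] by linarith
  qed
  \<comment> \<open>Both sides count ordered pairs of distinct vertices, the left one factor by
    factor.\<close>
  have total: "(\<Sum>i\<in>{1..k}. 2 * real (q i) * real N - real (q i) * (real (q i) + 1) * real (n i))
      = real N * (real N - 1)"
  proof -
    have "(\<Sum>i\<in>{1..k}. 2 * real (q i) * real N - real (q i) * (real (q i) + 1) * real (n i))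
        = (\<Sum>i\<in>{1..k}. \<Sum>v\<in>{1..N}. real (degree (H i) v))"
      using near_equal_cliques_degrees(3)[OF iso finH rn] VH N
      by (intro sum.cong) auto
    also have "\<dots> = (\<Sum>v\<in>{1..N}. real (\<Sum>i\<in>{1..k}. degree (H i) v))"
      by (subst sum.swap) simp
    also have "\<dots> = real N * (real N - 1)"
      using sum_degree_factorization[OF assms(2)] assms(1) by (simp add: of_nat_diff)
    finally show ?thesis .
  qed
  have upper: "?P (N + 1)"
    unfolding complementary_Ramsey_property_def
  proof (rule ballI, rule ccontr)
    fix f assume f: "f \<in> edge_colorings (N + 1) k"
    define G where "G = color_graph (N + 1) f"
    assume "\<not> (\<exists>i\<in>{1..k}. n i + 1 \<le> independence_number (color_graph (N + 1) f i))"
    then have alpha: "independence_number (G i) \<le> n i" if "i \<in> {1..k}" for i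
      using that unfolding G_def by (metis Suc_eq_plus1 not_less_eq_eq)
    have VG: "verts (G i) = {1..N + 1}" for i
      by (simp add: G_def color_graph_def)
    have degG: "(\<Sum>i\<in>{1..k}. degree (G i) v) = N" if "v \<in> {1..N + 1}" for v
      using sum_degree_factorization[OF factorable_into_color_graph[OF f] that] by (simp add: G_def)
    \<comment> \<open>For colour i, \<open>a i\<close> is the weighted Caro--Wei slack and
      \<open>b i\<close> the total defect.\<close>
    define a where "a i = real (q i) * (real (q i) + 1) *
      (real (n i) - (\<Sum>v\<in>{1..N + 1}. 1 / (real (degree (G i) v) + 1)))" for i
    define b where "b i = (\<Sum>v\<in>{1..N + 1}. degree_defect (q i) (degree (G i) v))" for i
    have slack: "(\<Sum>v\<in>{1..N + 1}. 1 / (real (degree (G i) v) + 1)) \<le> real (n i)"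
      if "i \<in> {1..k}" for i
      using Caro_Wei[of "G i"] alpha[OF that] VG by fastforce
    have a0: "a i \<ge> 0" if "i \<in> {1..k}" for i
      unfolding a_def using slack[OF that] by (intro mult_nonneg_nonneg) auto
    have b0: "b i \<ge> 0" for i
      unfolding b_def by (intro sum_nonneg degree_defect_nonneg)
    have "real (N + 1) * real N = (\<Sum>v\<in>{1..N + 1}. real (\<Sum>i\<in>{1..k}. degree (G i) v))"
      using degG by simp
    also have "\<dots> = (\<Sum>i\<in>{1..k}. \<Sum>v\<in>verts (G i). real (degree (G i) v))"
      unfolding VG by (subst sum.swap) simp
    also have "\<dots> = (\<Sum>i\<in>{1..k}. 2 * real (q i) * real (card (verts (G i)))
        - real (q i) * (real (q i) + 1) * real (n i) + a i + b i)"
      using sum_degree_eq_defect[where G = "G i" and q = "q i" and m = "n i" for i]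
      by (simp only: a_def b_def VG)
    \<comment> \<open>Splitting off 2 q_i, the contribution of the extra vertex, leaves the summand
      of \<open>total\<close>.\<close>
    also have "\<dots> = (\<Sum>i\<in>{1..k}. (2 * real (q i) * real N
        - real (q i) * (real (q i) + 1) * real (n i)) + 2 * real (q i) + (a i + b i))"
      by (simp add: VG algebra_simps)
    also have "\<dots> = real N * (real N - 1) + 2 * real (\<Sum>i\<in>{1..k}. q i)
        + (\<Sum>i\<in>{1..k}. a i + b i)"
      by (simp only: sum.distrib total) (simp add: sum_distrib_left)
    finally have eq: "2 * real N = 2 * real (\<Sum>i\<in>{1..k}. q i) + (\<Sum>i\<in>{1..k}. a i + b i)"
      by (simp add: algebra_simps)
    have ab0: "(\<Sum>i\<in>{1..k}. a i + b i) \<ge> 0"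
      using a0 b0 by (intro sum_nonneg) (simp add: add_nonneg_nonneg)
    have "real N \<le> real (\<Sum>i\<in>{1..k}. q i)" using sumq by (simp only: of_nat_le_iff)
    with eq ab0 have ab: "(\<Sum>i\<in>{1..k}. a i + b i) = 0"
      and qN: "real (\<Sum>i\<in>{1..k}. q i) = real N" by linarith+
    have abi: "a i + b i = 0" if "i \<in> {1..k}" for i
      using ab a0 b0 that by (subst (asm) sum_nonneg_eq_0_iff) (auto simp: add_nonneg_nonneg)
    have a: "a i = 0" and b: "b i = 0" if "i \<in> {1..k}" for i
      using abi[OF that] a0[OF that] b0[of i] by linarith+
    have le: "degree (G i) v \<le> q i" if "i \<in> {1..k}" "v \<in> {1..N + 1}" for i v
      using b[OF that(1)] that(2) unfolding b_def
      by (subst (asm) sum_nonneg_eq_0_iff)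
        (auto simp: degree_defect_nonneg intro: degree_defect_eq_0D)
    \<comment> \<open>The degrees at v and the q_i both sum to N, so no degree can fall short of its
      bound.\<close>
    have degs: "degree (G s) v = q s" if v: "v \<in> {1..N + 1}" for v
    proof (rule ccontr)
      assume "degree (G s) v \<noteq> q s"
      then have "degree (G s) v < q s" using le[OF s(1) v] by linarith
      then have "(\<Sum>i\<in>{1..k}. degree (G i) v) < (\<Sum>i\<in>{1..k}. q i)"
        using le[OF _ v] s(1) by (intro sum_strict_mono_ex1) auto
      then show False using degG[OF v] qN by (simp only: of_nat_eq_iff)
    qed
    \<comment> \<open>Since q_s > 0, the factor q_s(q_s+1) in \<open>a s\<close> is nonzero, so
      Caro--Wei is tight for colour s.\<close>
    have "real (n s) = (\<Sum>v\<in>{1..N + 1}. 1 / (real (degree (G s) v) + 1))"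
      using a[OF s(1)] s(2) by (simp add: a_def add_nonneg_eq_0_iff)
    also have "\<dots> = real (N + 1) / (real (q s) + 1)"
      using degs by simp
    finally have "real (n s) * (real (q s) + 1) = real (N + 1)"
      by (simp add: field_simps)
    then have "real (n s * (q s + 1)) = real (N + 1)" by (simp add: algebra_simps)
    then have "n s * (q s + 1) = N + 1" by (simp only: of_nat_eq_iff)
    \<comment> \<open>Comparison with N = n_s q_s + r_s makes n_s - r_s - 1 zero, against the choice
      of s.\<close>
    then have "n s = r s + 1" using N[OF s(1)] by simp
    then show False using s(2) by simp
  qed
  have "(LEAST M. M > 0 \<and> ?P M) = N + 1"
  proof (rule Least_equality)
    show "N + 1 \<le> M" if "M > 0 \<and> ?P M" for M
      using lower[of M] that by linarith
  qed (use upper in simp)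
  then show ?thesis
    unfolding complementary_Ramsey_def using upper by (metis add_gr_0 zero_less_one)
qed

end
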